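(* Let $\Phi(z)=\exp(-z)$, let $X_1,X_2\in\mathcal S_\star$ be standardized star shapes and let $\varepsilon\ge 0$. If $\mathtt d_{R\star}(X_1,X_2)\le\varepsilon$, then the corresponding sketches $\psi_1,\psi_2$ satisfy $\|\psi_1-\psi_2\|_{L_2}\le 2e\,\varepsilon$.
   Context: A standardized star shape ($X\in\mathcal S_\star$) is a compact set $X\subset\mathbb R^2$ whose mean point (centroid) is the origin, with $\max_{x\in X}\|x\|\le1$, and such that every $x\in X$ is joined to the origin by a segment contained in $X$. The ray from the origin at angle $\theta$ meets $X$ exactly in the points at distance in $[0,X(\theta)]$ from the origin, with $X(\theta)\in(0,1]$; $X(\cdot)$ is regarded as a $2\pi$-periodic function. Define $$\mathtt d_\star(X_1,X_2)=\max_{\theta\in[0,2\pi)}|X_1(\theta)-X_2(\theta)|,\qquad \mathtt d_{R\star}(X_1,X_2)=\min_{R\in\mathbb{SO}(2)}\mathtt d_\star(X_1,R(X_2)).$$ The sketch of $X_i$ is $\psi_i(\alpha)=\frac1{2\pi}\int_0^{2\pi}\Phi(X_i(\theta)-X_i(\theta+\alpha))\,d\theta$, and $\|\psi\|_{L_2}^2=\frac1{2\pi}\int_0^{2\pi}\psi(\alpha)^2\,d\alpha$. *)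

theory Defs
  imports "HOL-Analysis.Analysis"
begin

definition direction :: "real \<Rightarrow> real^2" where
  "direction \<theta> = vector [cos \<theta>, sin \<theta>]"

text \<open>
  The radial function, written \<open>X(\<theta>)\<close> on paper. It is defined for all real \<open>\<theta>\<close> and
  \<open>2\<pi>\<close>-periodic by construction. The supremum is attained for the sets considered here,
  see \<open>ray_inter_star_shape\<close> below.
\<close>
definition radial :: "(real^2) set \<Rightarrow> real \<Rightarrow> real" where
  "radial X \<theta> = Sup {r. 0 \<le> r \<and> r *\<^sub>R direction \<theta> \<in> X}"

definition centroid :: "(real^2) set \<Rightarrow> real^2" where
  "centroid X = (1 / measure lborel X) *\<^sub>R (LBINT x:X. x)"

text \<open>
  Positivity of the radial function forces the area of \<open>X\<close> to be positive, so that no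
  division by zero is hidden in \<open>centroid X\<close>. Nonemptiness must be explicit because the
  supremum of the empty set of reals is an unspecified number.
\<close>
definition standardized_star_shape :: "(real^2) set \<Rightarrow> bool" where
  "standardized_star_shape X \<longleftrightarrow>
     compact X \<and> X \<noteq> {} \<and>
     centroid X = 0 \<and>
     (\<forall>x\<in>X. norm x \<le> 1) \<and>
     (\<forall>x\<in>X. closed_segment 0 x \<subseteq> X) \<and>
     (\<forall>\<theta>. 0 < radial X \<theta>)"

text \<open>
  The radial function is only upper semicontinuous in general, so the maximum over \<open>\<theta>\<close> and
  the minimum over rotations are read as supremum and infimum.
\<close>
definition d_star :: "(real^2) set \<Rightarrow> (real^2) set \<Rightarrow> real" where
  "d_star X Y = (SUP \<theta>\<in>{0..<2*pi}. \<bar>radial X \<theta> - radial Y \<theta>\<bar>)"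

definition d_Rstar :: "(real^2) set \<Rightarrow> (real^2) set \<Rightarrow> real" where
  "d_Rstar X Y = (INF R\<in>{R :: real^2^2. rotation_matrix R}. d_star X ((\<lambda>y. R *v y) ` Y))"

definition sketch :: "(real \<Rightarrow> real) \<Rightarrow> (real^2) set \<Rightarrow> real \<Rightarrow> real" where
  "sketch \<Phi> X \<alpha> =
     1 / (2*pi) * (LBINT \<theta>:{0..2*pi}. \<Phi> (radial X \<theta> - radial X (\<theta> + \<alpha>)))"

definition L2_norm :: "(real \<Rightarrow> real) \<Rightarrow> real" where
  "L2_norm f = sqrt (1 / (2*pi) * (LBINT \<alpha>:{0..2*pi}. (f \<alpha>)\<^sup>2))"

lemma norm_direction [simp]: "norm (direction \<theta>) = 1"
  by (simp add: direction_def norm_vec_def L2_set_def sum_2)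

lemma ray_inter_star_shape:
  assumes "standardized_star_shape X"
  shows "{r. 0 \<le> r \<and> r *\<^sub>R direction \<theta> \<in> X} = {0..radial X \<theta>}"
    and "radial X \<theta> \<in> {0<..1}"
proof -
  let ?S = "{r. 0 \<le> r \<and> r *\<^sub>R direction \<theta> \<in> X}"
  have X: "compact X" "X \<noteq> {}" "\<And>x. x \<in> X \<Longrightarrow> norm x \<le> 1"
      "\<And>x. x \<in> X \<Longrightarrow> closed_segment 0 x \<subseteq> X" "0 < radial X \<theta>"
    using assms by (auto simp: standardized_star_shape_def)
  have "0 \<in> X" using X(2,4) by fastforce
  hence ne: "?S \<noteq> {}" by auto
  have le1: "r \<le> 1" if "r \<in> ?S" for r using X(3)[of "r *\<^sub>R direction \<theta>"] that by simp
  hence bdd: "bdd_above ?S" by (auto simp: bdd_above_def)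
  have "closed {r. r *\<^sub>R direction \<theta> \<in> X}"
    using continuous_closed_vimage[of X "\<lambda>r. r *\<^sub>R direction \<theta>"] compact_imp_closed[OF X(1)]
    by (simp add: vimage_def)
  hence "closed ({0..} \<inter> {r. r *\<^sub>R direction \<theta> \<in> X})" by (intro closed_Int) auto
  moreover have "{0..} \<inter> {r. r *\<^sub>R direction \<theta> \<in> X} = ?S" by auto
  ultimately have "closed ?S" by simp
  hence mem: "radial X \<theta> \<in> ?S"
    unfolding radial_def using closed_contains_Sup[OF ne bdd] by simp
  show "radial X \<theta> \<in> {0<..1}" using le1[OF mem] X(5) by simp
  show "?S = {0..radial X \<theta>}"
  proof (intro set_eqI iffI)
    fix r assume "r \<in> ?S"
    thus "r \<in> {0..radial X \<theta>}" unfolding radial_def using cSup_upper[OF _ bdd] by auto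
  next
    fix r assume r: "r \<in> {0..radial X \<theta>}"
    have "r *\<^sub>R direction \<theta> = (r / radial X \<theta>) *\<^sub>R (radial X \<theta> *\<^sub>R direction \<theta>)"
      using X(5) by simp
    moreover have "0 \<le> r / radial X \<theta>" "r / radial X \<theta> \<le> 1" using r X(5) by auto
    ultimately have "r *\<^sub>R direction \<theta> \<in> closed_segment 0 (radial X \<theta> *\<^sub>R direction \<theta>)"
      unfolding in_segment by (intro exI[of _ "r / radial X \<theta>"]) simp
    thus "r \<in> ?S" using X(4)[of "radial X \<theta> *\<^sub>R direction \<theta>"] mem r by auto
  qed
qed

end

theory Submission imports Defs begin

text \<open>
  The sketch is invariant under rotations of the shape, because the integral of a periodic function
  over a full period is invariant under translation. After rotating \<open>X2\<close>, the differences
  \<open>X1(\<theta>) - X1(\<theta> + \<alpha>)\<close> and \<open>X2(\<theta>) - X2(\<theta> + \<alpha>)\<close> lie in \<open>[-1, 1]\<close> and are within twice the distance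
  of the shapes. On that interval \<open>exp (- z)\<close> is Lipschitz with constant \<open>e\<close>, so the sketches are
  uniformly close, hence close in \<open>L\<^sub>2\<close>.
\<close>

section \<open>Integrals over a period, integral bounds and the Lipschitz estimate\<close>

lemma integral_shift_periodic:
  fixes f :: "real \<Rightarrow> 'a::banach"
  assumes f: "\<And>a b. f integrable_on {a..b}" and periodic: "\<And>x. f (x + p) = f x"
    and t: "0 \<le> t" "t \<le> p"
  shows "integral {0..p} (\<lambda>x. f (x + t)) = integral {0..p} f"
proof -
  have shift: "integral {a..b} (\<lambda>x. f (x + c)) = integral {a+c..b+c} f" for a b c
    using integral_shift_Icc_real[of a b f c] by (simp add: o_def add.commute)
  have "integral {0..p} (\<lambda>x. f (x + t)) = integral {t..p+t} f"
    using shift[of 0 p t] by simp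
  \<comment> \<open>Cut the translated window at \<open>p\<close>: periodicity moves the overhang
    \<open>{p..p+t}\<close> back to \<open>{0..t}\<close>, the piece missing at the left.\<close>
  also have "\<dots> = integral {t..p} f + integral {p..p+t} f"
    using Henstock_Kurzweil_Integration.integral_combine[OF _ _ f, of t p "p+t"] t by simp
  also have "integral {p..p+t} f = integral {0..t} f"
    using shift[of 0 t p] by (simp add: periodic add.commute)
  also have "integral {t..p} f + integral {0..t} f = integral {0..p} f"
    using Henstock_Kurzweil_Integration.integral_combine[OF _ _ f, of 0 t p] t
    by (simp add: add.commute)
  finally show ?thesis .
qed

lemma set_integrable_bounded_Icc:
  fixes f :: "real \<Rightarrow> real"
  assumes "f \<in> borel_measurable borel" "\<And>x. \<bar>f x\<bar> \<le> B"
  shows "set_integrable lborel {a..b} f"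
  unfolding set_integrable_def
proof (rule Bochner_Integration.integrable_bound)
  show "integrable lborel (\<lambda>x. B * indicator {a..b} x)"
    by (intro integrable_mult_right integrable_real_indicator) (auto simp: emeasure_lborel_Icc_eq)
  show "(\<lambda>x. indicator {a..b} x *\<^sub>R f x) \<in> borel_measurable lborel"
    using assms(1) by simp
  show "AE x in lborel. norm (indicator {a..b} x *\<^sub>R f x) \<le> norm (B * indicator {a..b} x)"
    using assms(2) order_trans[OF assms(2) abs_ge_self]
    by (intro AE_I2) (simp split: split_indicator)
qed

text \<open>Monotonicity against the constant \<open>B\<close>, whose integral exists. If
  \<open>f\<close> is not integrable, its integral is 0 by convention and \<open>0 \<le> B\<close>
  covers that case; hence differences of sketches can be bounded in \<open>L2_norm\<close> without
  discussing their measurability in \<open>\<alpha>\<close>.\<close>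

lemma set_lebesgue_integral_bound_Icc:
  fixes f :: "real \<Rightarrow> real"
  assumes "a \<le> b" "0 \<le> B" "\<And>x. f x \<le> B"
  shows "(LBINT x:{a..b}. f x) \<le> B * (b - a)"
proof -
  have "(LBINT x:{a..b}. f x) \<le> (\<integral>x. B * indicator {a..b} x \<partial>lborel)"
    unfolding set_lebesgue_integral_def
    by (rule integral_mono') (use assms in \<open>auto split: split_indicator\<close>)
  then show ?thesis using assms by simp
qed

lemma L2_norm_le:
  assumes "0 \<le> B" "\<And>x. \<bar>f x\<bar> \<le> B"
  shows "L2_norm f \<le> B"
proof -
  have "(f x)\<^sup>2 \<le> B\<^sup>2" for x
    using assms by (metis abs_ge_zero power2_abs power_mono)
  then have "(LBINT x:{0..2*pi}. (f x)\<^sup>2) \<le> B\<^sup>2 * (2*pi - 0)"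
    by (intro set_lebesgue_integral_bound_Icc) auto
  then have "1 / (2*pi) * (LBINT x:{0..2*pi}. (f x)\<^sup>2) \<le> B\<^sup>2"
    by (simp add: field_simps)
  then show ?thesis
    unfolding L2_norm_def using assms(1) by (intro real_le_lsqrt) auto
qed

text \<open>The slope of \<open>exp (- z)\<close> is at most \<open>exp c\<close> in absolute value
  for \<open>z \<ge> - c\<close>, so lower bounds on the arguments suffice.\<close>

lemma exp_minus_lipschitz:
  fixes x y c :: real
  assumes "- c \<le> x" "- c \<le> y"
  shows "\<bar>exp (- x) - exp (- y)\<bar> \<le> exp c * \<bar>x - y\<bar>"
proof -
  have *: "exp (- u) - exp (- v) \<le> exp c * (v - u)" if "u \<le> v" "- c \<le> u" for u v :: real
  proof -
    \<comment> \<open>The tangent inequality \<open>1 + w \<le> exp w\<close> at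
      \<open>w = u - v\<close> replaces the mean value theorem; \<open>exp (- u) \<le> exp c\<close>
      supplies the constant.\<close>
    have "1 - exp (u - v) \<le> v - u"
      using exp_ge_add_one_self[of "u - v"] by linarith
    then have "exp (- u) * (1 - exp (u - v)) \<le> exp c * (v - u)"
      using that by (intro mult_mono) auto
    moreover have "exp (- u) * exp (u - v) = exp (- v)"
      by (simp flip: exp_add)
    ultimately show ?thesis by (simp add: right_diff_distrib)
  qed
  show ?thesis
    using *[of x y] *[of y x] assms by (cases "x \<le> y") (auto simp: abs_if)
qed

section \<open>Directions, radial functions and rotations\<close>

lemma direction_periodic: "direction (\<theta> + 2*pi) = direction \<theta>"
  by (simp add: direction_def)

text \<open>\<open>d_star\<close> ranges over \<open>{0..<2*pi}\<close> only; this transfers its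
  bound to arbitrary real angles.\<close>

lemma direction_representative:
  obtains \<theta>' where "\<theta>' \<in> {0..<2*pi}" "direction \<theta>' = direction \<theta>"
proof -
  obtain t where "0 \<le> t" "t < 2*pi" "cos \<theta> = cos t" "sin \<theta> = sin t"
    using sincos_total_2pi[of "cos \<theta>" "sin \<theta>"] by (metis sin_cos_squared_add2)
  then show ?thesis
    by (intro that[of t]) (simp_all add: direction_def)
qed

lemma continuous_on_direction: "continuous_on S direction"
proof -
  have "direction = (\<lambda>\<theta>. cos \<theta> *\<^sub>R axis 1 1 + sin \<theta> *\<^sub>R axis 2 1)"
    by (rule ext) (simp add: direction_def vec_eq_iff forall_2 axis_def)
  then show ?thesis by (rule ssubst) (intro continuous_intros)
qed

lemma radial_cong_direction: "direction \<theta> = direction \<theta>' \<Longrightarrow> radial X \<theta> = radial X \<theta>'"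
  by (simp add: radial_def)

text \<open>Upper semicontinuity: for \<open>c \<ge> 0\<close> the superlevel set is the preimage of
  the closed set \<open>X\<close> under the continuous map
  \<open>\<lambda>\<theta>. c *\<^sub>R direction \<theta>\<close>; for \<open>c < 0\<close> it is
  the whole line.\<close>

lemma radial_measurable:
  assumes X: "standardized_star_shape X"
  shows "radial X \<in> borel_measurable borel"
  unfolding borel_measurable_iff_ge
proof
  fix c
  show "{\<theta> \<in> space borel. c \<le> radial X \<theta>} \<in> sets borel"
  proof (cases "0 \<le> c")
    case True
    then have "{\<theta> \<in> space borel. c \<le> radial X \<theta>} = (\<lambda>\<theta>. c *\<^sub>R direction \<theta>) -` X"
      using ray_inter_star_shape(1)[OF X] by (auto simp: set_eq_iff)
    moreover have "closed X"
      using X by (auto simp: standardized_star_shape_def compact_imp_closed)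
    ultimately show ?thesis
      by (simp add: closed_vimage continuous_on_scaleR continuous_on_direction)
  next
    case False
    then have "{\<theta> \<in> space borel. c \<le> radial X \<theta>} = UNIV"
      using order_trans[OF less_imp_le less_imp_le] ray_inter_star_shape(2)[OF X]
      by (auto simp: not_le)
    then show ?thesis by simp
  qed
qed

lemma rotation_matrix_direction:
  fixes R :: "real^2^2"
  assumes "rotation_matrix R"
  obtains t where "0 \<le> t" "t \<le> 2*pi" "\<And>\<theta>. R *v direction \<theta> = direction (\<theta> + t)"
proof -
  let ?a = "R$1$1" and ?b = "R$1$2" and ?c = "R$2$1" and ?d = "R$2$2"
  have "transpose R ** R = mat 1" and det: "?a * ?d - ?b * ?c = 1"
    using assms by (auto simp: rotation_matrix_def orthogonal_matrix det_2)
  then have cols: "?a\<^sup>2 + ?c\<^sup>2 = 1" "?b\<^sup>2 + ?d\<^sup>2 = 1"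
    by (auto simp: vec_eq_iff forall_2 matrix_matrix_mult_def transpose_def mat_def sum_2
        power2_eq_square)
  \<comment> \<open>The left side expands to the sum of the squared column norms minus twice the
    determinant, that is \<open>2 - 2\<close>.\<close>
  have "(?a - ?d)\<^sup>2 + (?b + ?c)\<^sup>2 = 0"
    using cols det by (simp add: power2_eq_square algebra_simps)
  then have eq: "?d = ?a" "?b = - ?c"
    by (simp_all add: sum_power2_eq_zero_iff)
  obtain t where t: "0 \<le> t" "t < 2*pi" "?a = cos t" "?c = sin t"
    using sincos_total_2pi[OF cols(1)] by blast
  have "R *v direction \<theta> = direction (\<theta> + t)" for \<theta>
    by (simp add: vec_eq_iff forall_2 matrix_vector_mult_def sum_2 direction_def eq t
        cos_add sin_add)
  with t show ?thesis by (intro that[of t]) auto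
qed

text \<open>\<open>R\<close> maps the ray at \<open>\<theta>\<close> linearly onto the ray at
  \<open>\<theta> + t\<close> and is injective, so both suprema run over the same set of
  radii.\<close>

lemma radial_rotation:
  fixes R :: "real^2^2"
  assumes "rotation_matrix R" "\<And>\<theta>. R *v direction \<theta> = direction (\<theta> + t)"
  shows "radial ((\<lambda>y. R *v y) ` X) (\<theta> + t) = radial X \<theta>"
proof -
  have "inj ((*v) R)"
    using assms(1)
    by (intro inj_matrix_vector_mult) (simp add: rotation_matrix_def invertible_det_nz)
  moreover have "r *\<^sub>R direction (\<theta> + t) = R *v (r *\<^sub>R direction \<theta>)" for r
    by (simp add: assms(2) matrix_vector_mult_scaleR)
  ultimately show ?thesis
    unfolding radial_def by (simp add: inj_image_mem_iff)
qed

section \<open>Sketches under angular shifts and their distance\<close>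

context
  fixes X :: "(real^2) set"
  assumes X: "standardized_star_shape X"
begin

text \<open>Separate shifts \<open>s\<close> and \<open>u\<close> let one statement cover the
  integrand of the sketch and its translates.\<close>

lemma sketch_integrand_measurable:
  "(\<lambda>\<theta>. exp (- (radial X (\<theta> + s) - radial X (\<theta> + u)))) \<in> borel_measurable borel"
proof -
  have [measurable]: "radial X \<in> borel_measurable borel"
    by (rule radial_measurable[OF X])
  show ?thesis by measurable
qed

lemma sketch_integrand_bounded: "\<bar>exp (- (radial X \<theta> - radial X \<theta>'))\<bar> \<le> exp 1"
  using ray_inter_star_shape(2)[OF X, of \<theta>] ray_inter_star_shape(2)[OF X, of \<theta>'] by auto

lemma sketch_integrand_integrable:
  "set_integrable lborel {a..b} (\<lambda>\<theta>. exp (- (radial X (\<theta> + s) - radial X (\<theta> + u))))"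
  by (rule set_integrable_bounded_Icc[OF sketch_integrand_measurable sketch_integrand_bounded])

text \<open>Rotation invariance in the form used later: the angle of the unrotated shape is shifted
  inside the integral, so that no sketch of a rotated set has to be considered.\<close>

lemma sketch_shift:
  assumes "0 \<le> t" "t \<le> 2*pi"
  shows "sketch (\<lambda>z. exp (- z)) X \<alpha> =
    1 / (2*pi) * (LBINT \<theta>:{0..2*pi}. exp (- (radial X (\<theta> + t) - radial X (\<theta> + (t + \<alpha>)))))"
proof -
  define f where "f \<theta> = exp (- (radial X \<theta> - radial X (\<theta> + \<alpha>)))" for \<theta>
  have int: "set_integrable lborel {a..b} (\<lambda>\<theta>. f (\<theta> + s))" for a b s
    using sketch_integrand_integrable[of a b s "s + \<alpha>"] by (simp add: f_def add.assoc)
  have int0: "set_integrable lborel {a..b} f" for a b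
    using int[of a b 0] by simp
  have periodic: "f (\<theta> + 2*pi) = f \<theta>" for \<theta>
  proof -
    have "direction (\<theta> + 2*pi + \<alpha>) = direction (\<theta> + \<alpha>)"
      using direction_periodic[of "\<theta> + \<alpha>"] by (simp add: algebra_simps)
    then show ?thesis
      unfolding f_def
      using radial_cong_direction[of "\<theta> + 2*pi + \<alpha>" "\<theta> + \<alpha>" X]
        radial_cong_direction[OF direction_periodic, of X \<theta>] by simp
  qed
  have "(LBINT \<theta>:{0..2*pi}. f (\<theta> + t)) = integral {0..2*pi} (\<lambda>\<theta>. f (\<theta> + t))"
    using int by (rule set_borel_integral_eq_integral)
  also have "\<dots> = integral {0..2*pi} f"
    using set_borel_integral_eq_integral(1)[OF int0] periodic assms
    by (rule integral_shift_periodic)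
  also have "\<dots> = (LBINT \<theta>:{0..2*pi}. f \<theta>)"
    using set_borel_integral_eq_integral(2)[OF int0] by simp
  finally show ?thesis by (simp add: sketch_def f_def add.assoc)
qed

end

lemma sketch_diff_le:
  assumes X: "standardized_star_shape X" and Y: "standardized_star_shape Y"
    and t: "0 \<le> t" "t \<le> 2*pi"
    and dist: "\<And>\<theta>. \<bar>radial X (\<theta> + t) - radial Y \<theta>\<bar> \<le> d"
  shows "\<bar>sketch (\<lambda>z. exp (- z)) X \<alpha> - sketch (\<lambda>z. exp (- z)) Y \<alpha>\<bar> \<le> 2 * exp 1 * d"
proof -
  define f where "f \<theta> = exp (- (radial X (\<theta> + t) - radial X (\<theta> + (t + \<alpha>))))" for \<theta>
  define g where "g \<theta> = exp (- (radial Y \<theta> - radial Y (\<theta> + \<alpha>)))" for \<theta>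
  have fi: "set_integrable lborel {0..2*pi} f"
    unfolding f_def by (rule sketch_integrand_integrable[OF X])
  have gi: "set_integrable lborel {0..2*pi} g"
    using sketch_integrand_integrable[OF Y, of 0 "2*pi" 0 \<alpha>] by (simp add: g_def[abs_def])
  have "0 \<le> d" using dist[of 0] by linarith
  have fg: "\<bar>f \<theta> - g \<theta>\<bar> \<le> 2 * exp 1 * d" for \<theta>
  proof -
    \<comment> \<open>Radial values lie in \<open>{0<..1}\<close>, so both differences are at least
      -1 and \<open>c = 1\<close> gives the constant \<open>exp 1\<close>.\<close>
    have "\<bar>f \<theta> - g \<theta>\<bar> \<le> exp 1 * \<bar>(radial X (\<theta> + t) - radial X (\<theta> + (t + \<alpha>)))
        - (radial Y \<theta> - radial Y (\<theta> + \<alpha>))\<bar>"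
      unfolding f_def g_def
      using ray_inter_star_shape(2)[OF X, of "\<theta> + t"]
        ray_inter_star_shape(2)[OF X, of "\<theta> + (t + \<alpha>)"]
        ray_inter_star_shape(2)[OF Y, of \<theta>] ray_inter_star_shape(2)[OF Y, of "\<theta> + \<alpha>"]
      by (intro exp_minus_lipschitz) auto
    also have "\<dots> \<le> exp 1 * (2 * d)"
    proof (rule mult_left_mono)
      \<comment> \<open>\<open>dist\<close> enters at \<open>\<theta>\<close> and at
        \<open>\<theta> + \<alpha>\<close>, which is the source of the factor 2.\<close>
      have "\<bar>radial X (\<theta> + (t + \<alpha>)) - radial Y (\<theta> + \<alpha>)\<bar> \<le> d"
        using dist[of "\<theta> + \<alpha>"] by (simp add: ac_simps)
      then show "\<bar>(radial X (\<theta> + t) - radial X (\<theta> + (t + \<alpha>)))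
          - (radial Y \<theta> - radial Y (\<theta> + \<alpha>))\<bar> \<le> 2 * d"
        using dist[of \<theta>] by linarith
    qed simp
    finally show ?thesis by simp
  qed
  \<comment> \<open>The integral bound is one-sided, so the difference is integrated with both
    signs.\<close>
  have "(LBINT \<theta>:{0..2*pi}. f \<theta> - g \<theta>) \<le> 2 * exp 1 * d * (2*pi - 0)"
    "(LBINT \<theta>:{0..2*pi}. g \<theta> - f \<theta>) \<le> 2 * exp 1 * d * (2*pi - 0)"
    using \<open>0 \<le> d\<close> fg by (intro set_lebesgue_integral_bound_Icc; simp add: abs_le_iff)+
  then have "\<bar>(LBINT \<theta>:{0..2*pi}. f \<theta>) - (LBINT \<theta>:{0..2*pi}. g \<theta>)\<bar> \<le> 2 * exp 1 * d * (2*pi)"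
    using fi gi by (simp add: set_integral_diff)
  moreover have "sketch (\<lambda>z. exp (- z)) X \<alpha> - sketch (\<lambda>z. exp (- z)) Y \<alpha> =
      ((LBINT \<theta>:{0..2*pi}. f \<theta>) - (LBINT \<theta>:{0..2*pi}. g \<theta>)) / (2*pi)"
    using sketch_shift[OF X t, of \<alpha>]
    by (simp add: sketch_def f_def g_def diff_divide_distrib)
  ultimately show ?thesis by (simp add: abs_divide divide_le_eq)
qed

lemma sketch_L2_dist_le_d_star:
  fixes R :: "real^2^2"
  assumes X: "standardized_star_shape X" and Y: "standardized_star_shape Y"
    and R: "rotation_matrix R"
  shows "L2_norm (\<lambda>\<alpha>. sketch (\<lambda>z. exp (- z)) X \<alpha> - sketch (\<lambda>z. exp (- z)) Y \<alpha>)
    \<le> 2 * exp 1 * d_star X ((\<lambda>y. R *v y) ` Y)"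
proof -
  let ?Y = "(\<lambda>y. R *v y) ` Y"
  let ?d = "d_star X ?Y"
  obtain t where t: "0 \<le> t" "t \<le> 2*pi" and Rt: "\<And>\<theta>. R *v direction \<theta> = direction (\<theta> + t)"
    using rotation_matrix_direction[OF R] by metis
  \<comment> \<open>The image of \<open>Y\<close> enters only through its radial function, which
    inherits the range \<open>{0<..1}\<close> from \<open>Y\<close>; this bounds the family whose
    supremum is \<open>?d\<close>.\<close>
  have rad: "radial ?Y \<theta> = radial Y (\<theta> - t)" for \<theta>
    using radial_rotation[OF R Rt, of Y "\<theta> - t"] by simp
  have "\<bar>radial X \<theta> - radial ?Y \<theta>\<bar> \<le> 1" for \<theta>
    using ray_inter_star_shape(2)[OF X, of \<theta>] ray_inter_star_shape(2)[OF Y, of "\<theta> - t"]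
    by (auto simp: rad)
  then have bdd: "bdd_above ((\<lambda>\<theta>. \<bar>radial X \<theta> - radial ?Y \<theta>\<bar>) ` {0..<2*pi})"
    by (auto simp: bdd_above_def)
  have dist: "\<bar>radial X \<theta> - radial ?Y \<theta>\<bar> \<le> ?d" for \<theta>
  proof -
    obtain \<theta>' where \<theta>': "\<theta>' \<in> {0..<2*pi}" "direction \<theta>' = direction \<theta>"
      by (rule direction_representative)
    have "\<bar>radial X \<theta>' - radial ?Y \<theta>'\<bar> \<le> ?d"
      unfolding d_star_def using \<theta>'(1) bdd by (rule cSUP_upper)
    then show ?thesis
      using radial_cong_direction[OF \<theta>'(2)] by simp
  qed
  have "\<bar>radial X (\<theta> + t) - radial Y \<theta>\<bar> \<le> ?d" for \<theta>
    using dist[of "\<theta> + t"] by (simp add: rad)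
  moreover have "0 \<le> ?d" using dist[of 0] by linarith
  ultimately show ?thesis
    by (intro L2_norm_le sketch_diff_le[OF X Y t]) auto
qed

theorem lemma4p3:
  fixes X1 X2 :: "(real^2) set" and \<epsilon> :: real
  assumes "standardized_star_shape X1"
    and "standardized_star_shape X2"
    and "0 \<le> \<epsilon>"
    and "d_Rstar X1 X2 \<le> \<epsilon>"
  shows "L2_norm (\<lambda>\<alpha>. sketch (\<lambda>z. exp (- z)) X1 \<alpha> - sketch (\<lambda>z. exp (- z)) X2 \<alpha>)
           \<le> 2 * exp 1 * \<epsilon>"
proof -
  let ?L = "L2_norm (\<lambda>\<alpha>. sketch (\<lambda>z. exp (- z)) X1 \<alpha> - sketch (\<lambda>z. exp (- z)) X2 \<alpha>)"
  \<comment> \<open>The identity shows that the infimum in \<open>d_Rstar\<close> is over a nonempty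
    set.\<close>
  have "rotation_matrix (mat 1 :: real^2^2)"
    by (simp add: rotation_matrix_def orthogonal_matrix_id)
  \<comment> \<open>Divided by \<open>2 * exp 1\<close>, the bound makes \<open>?L\<close> a lower
    bound for \<open>d_star\<close> over all rotations, hence for the infimum, whether or not it is
    attained.\<close>
  then have "?L / (2 * exp 1) \<le> d_Rstar X1 X2"
    unfolding d_Rstar_def using sketch_L2_dist_le_d_star[OF assms(1,2)]
    by (intro cINF_greatest) (auto simp: divide_le_eq mult.commute)
  also note assms(4)
  finally show ?thesis by (simp add: divide_le_eq mult.commute)
qed

end
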